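(* For every finite simple graph $G$ on $n$ vertices, $\alpha_{1}(G) + \tau_{B}(G) \le \frac{4403 n^2}{15000}$.
   Context: All graphs are finite, simple and undirected. A triangle-independent set in $G$ is a set of edges containing at most one edge from each triangle of $G$; $\alpha_{1}(G)$ denotes the maximum size of a triangle-independent set in $G$. $\tau_{B}(G)$ denotes the minimum size of a set of edges whose deletion from $G$ leaves a bipartite graph. *)

theory Defs
  imports Complex_Main
begin

text \<open>A graph is given by its vertex set \<open>V\<close> and its set \<open>E\<close> of edges, each edge being
  a two-element set of vertices.\<close>

definition finite_simple_graph :: "'a set \<Rightarrow> 'a set set \<Rightarrow> bool" where
  "finite_simple_graph V E \<longleftrightarrow> finite V \<and> (\<forall>e\<in>E. e \<subseteq> V \<and> card e = 2)"

text \<open>A triangle is represented by the set of its three edges.\<close>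

definition triangles :: "'a set set \<Rightarrow> 'a set set set" where
  "triangles E = {{{x, y}, {y, z}, {x, z}} | x y z.
     x \<noteq> y \<and> y \<noteq> z \<and> x \<noteq> z \<and> {x, y} \<in> E \<and> {y, z} \<in> E \<and> {x, z} \<in> E}"

definition triangle_independent :: "'a set set \<Rightarrow> 'a set set \<Rightarrow> bool" where
  "triangle_independent E F \<longleftrightarrow> F \<subseteq> E \<and> (\<forall>T\<in>triangles E. card (F \<inter> T) \<le> 1)"

definition bipartite :: "'a set \<Rightarrow> 'a set set \<Rightarrow> bool" where
  "bipartite V E \<longleftrightarrow>
     (\<exists>A B. A \<union> B = V \<and> A \<inter> B = {} \<and> (\<forall>e\<in>E. \<exists>a\<in>A. \<exists>b\<in>B. e = {a, b}))"

text \<open>For a finite simple graph both sets of cardinalities below are finite and nonempty: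
  the empty set is triangle-independent, and deleting all edges leaves a bipartite graph.\<close>

definition alpha1 :: "'a set set \<Rightarrow> nat" where
  "alpha1 E = Max {card F | F. triangle_independent E F}"

definition tau_B :: "'a set \<Rightarrow> 'a set set \<Rightarrow> nat" where
  "tau_B V E = Min {card F | F. F \<subseteq> E \<and> bipartite V (E - F)}"

end

theory Submission
  imports Defs
begin

text \<open>The bound \<open>n\<^sup>2 / 4\<close> holds. Let \<open>F\<close> be triangle-independent. For a vertex \<open>v\<close> put the
  \<open>F\<close>-neighbours of \<open>v\<close> (an independent set) on one side and the non-neighbours of \<open>v\<close> on the other,
  cut the set \<open>R\<close> of the remaining vertices inductively, and flip the cut of \<open>R\<close> with
  probability 1/2. Summing the expected number of uncut edges over all \<open>v\<close> and sorting by the types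
  (non-edge, edge outside \<open>F\<close>, edge of \<open>F\<close>) of the three pairs in a triple, the slack is at least
  the sum over \<open>v\<close> of the square of the difference between the \<open>F\<close>-degree and the number of
  non-neighbours of \<open>v\<close>. Hence some \<open>v\<close> gives a good cut.

  The edges and the edges of \<open>F\<close> are encoded by 0/1-valued functions \<open>g\<close> and \<open>h\<close>. For the cut
  at \<open>v\<close>, the number \<open>g v x + h v x - 1\<close> is the side of \<open>x\<close>, with \<open>0\<close> meaning \<open>x \<in> R\<close>, while
  \<open>g v x - h v x\<close> is the indicator of \<open>R\<close>. Sums over ordered pairs count each edge twice.\<close>

section \<open>Averaging the cuts over all vertices\<close>

text \<open>Finite case check on the types of the three pairs in a triple. \<open>S\<close> is the
  slack of the third pair in the cut at the opposite vertex. One \<open>S\<close> alone can be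
  negative, so the three rotations are added.\<close>

lemma triple_slack_nonneg:
  fixes a b c p q r :: real
  assumes "(a, p) \<in> {(0, 0), (1, 0), (1, 1)}" "(b, q) \<in> {(0, 0), (1, 0), (1, 1)}"
    "(c, r) \<in> {(0, 0), (1, 0), (1, 1)}"
    and "p * q * c = 0" "q * r * a = 0" "p * r * b = 0"
  defines "S \<equiv> \<lambda>a p b q c r. (1 - (a - p) * (b - q)) *
      (1 - c * (1 + (a + p - 1) * (b + q - 1)) - 2 * r) - (a + p - 1) * (b + q - 1)"
  shows "0 \<le> S a p b q c r + S c r a p b q + S b q c r a p"
  using assms(1-6) unfolding S_def by (elim insertE emptyE Pair_inject) simp_all

lemma sum_rotate:
  fixes P :: "'a \<Rightarrow> 'a \<Rightarrow> 'a \<Rightarrow> real"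
  shows "(\<Sum>v\<in>V. \<Sum>x\<in>V. \<Sum>y\<in>V. P x y v) = (\<Sum>v\<in>V. \<Sum>x\<in>V. \<Sum>y\<in>V. P v x y)"
proof -
  have "(\<Sum>v\<in>V. \<Sum>x\<in>V. \<Sum>y\<in>V. P x y v) = (\<Sum>x\<in>V. \<Sum>v\<in>V. \<Sum>y\<in>V. P x y v)"
    by (rule sum.swap)
  also have "\<dots> = (\<Sum>x\<in>V. \<Sum>y\<in>V. \<Sum>v\<in>V. P x y v)"
    by (intro sum.cong refl sum.swap)
  finally show ?thesis .
qed

text \<open>Strong induction on \<open>V\<close>. The conditions on \<open>g\<close> and
  \<open>h\<close> range over the whole type, so they pass unchanged to the smaller set
  \<open>R\<close>.\<close>

lemma exists_good_cut:
  fixes g h :: "'a \<Rightarrow> 'a \<Rightarrow> real"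
  assumes "finite V"
    and vals: "\<And>x y. (g x y, h x y) \<in> {(0, 0), (1, 0), (1, 1)}"
    and loopless: "\<And>x. g x x = 0"
    and sym: "\<And>x y. g x y = g y x" "\<And>x y. h x y = h y x"
    and indep: "\<And>x y z. h x y * h x z * g y z = 0"
  shows "\<exists>s. (\<forall>x. s x \<in> {1, -1}) \<and>
    (\<Sum>x\<in>V. \<Sum>y\<in>V. g x y * (1 + s x * s y) / 2 + h x y) \<le> (real (card V))\<^sup>2 / 2"
  using \<open>finite V\<close>
proof (induction V rule: finite_psubset_induct)
  case (psubset V)
  show ?case
  proof (cases "V = {}")
    case True
    then show ?thesis by (auto intro!: exI[of _ "\<lambda>_. 1"])
  next
    case False
    define t where "t = (\<lambda>v x. g v x + h v x - 1)"
    define \<rho> where "\<rho> = (\<lambda>v x. g v x - h v x)"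
    \<comment> \<open>What a pair leaves of a budget of 1 after twice its expected cost; the first
      factor discards pairs inside \<open>R\<close>, which the induction pays for.\<close>
    define K where "K = (\<lambda>v x y. (1 - \<rho> v x * \<rho> v y) *
      (1 - g x y * (1 + t v x * t v y) - 2 * h x y))"
    define P where "P = (\<lambda>v x y. K v x y - t v x * t v y)"
    \<comment> \<open>Repeated vertices are covered too: a pair \<open>x\<close>, \<open>x\<close>
      has the type of a non-edge.\<close>
    have rot: "0 \<le> P v x y + P x y v + P y v x" for v x y
    proof -
      note flip = sym(1)[of x v] sym(2)[of x v] sym(1)[of y v] sym(2)[of y v]
        sym(1)[of y x] sym(2)[of y x]
      show ?thesis
        using triple_slack_nonneg[OF vals[of v x] vals[of v y] vals[of x y]
            indep[of v x y] indep[of y v x, unfolded flip] indep[of x v y, unfolded flip]]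
        unfolding P_def K_def \<rho>_def t_def flip .
    qed
    have "0 \<le> (\<Sum>v\<in>V. \<Sum>x\<in>V. \<Sum>y\<in>V. P v x y + P x y v + P y v x)"
      by (intro sum_nonneg rot)
    also have "\<dots> = 3 * (\<Sum>v\<in>V. \<Sum>x\<in>V. \<Sum>y\<in>V. P v x y)"
      using sum_rotate[of P V] sum_rotate[of "\<lambda>v x y. P x y v" V]
      by (simp add: sum.distrib)
    finally have "\<not> (\<Sum>v\<in>V. \<Sum>x\<in>V. \<Sum>y\<in>V. P v x y) < (\<Sum>v\<in>V. 0)"
      by simp
    then obtain v where v: "v \<in> V" "0 \<le> (\<Sum>x\<in>V. \<Sum>y\<in>V. P v x y)"
      using sum_strict_mono[OF psubset.hyps False, of "\<lambda>v. \<Sum>x\<in>V. \<Sum>y\<in>V. P v x y" "\<lambda>_. 0"]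
      by (meson not_le)
    \<comment> \<open>The term subtracted in \<open>P\<close> sums to a square, so dropping it keeps
      the total nonnegative.\<close>
    have "(\<Sum>x\<in>V. \<Sum>y\<in>V. t v x * t v y) = (\<Sum>x\<in>V. t v x)\<^sup>2"
      by (simp add: power2_eq_square sum_product)
    with v(2) have K: "0 \<le> (\<Sum>x\<in>V. \<Sum>y\<in>V. K v x y)"
      unfolding P_def by (simp add: sum_subtractf) (smt (verit) zero_le_power2)
    define R where "R = {x \<in> V. \<rho> v x = 1}"
    have \<rho>: "\<rho> v x = (if x \<in> R then 1 else 0)" if "x \<in> V" for x
      using vals[of v x] that by (auto simp: \<rho>_def R_def)
    \<comment> \<open>As its own non-neighbour, \<open>v\<close> falls outside \<open>R\<close>,
      which makes the induction descend.\<close>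
    have "v \<notin> R"
      using loopless[of v] vals[of v v] by (auto simp: R_def \<rho>_def)
    with v(1) have "R \<subset> V" unfolding R_def by blast
    with psubset.IH obtain s where s: "\<And>x. s x \<in> {1, -1}"
      and cut: "(\<Sum>x\<in>R. \<Sum>y\<in>R. g x y * (1 + s x * s y) / 2 + h x y) \<le> (real (card R))\<^sup>2 / 2"
      by blast
    have on_R: "(\<Sum>x\<in>V. \<Sum>y\<in>V. \<rho> v x * \<rho> v y * f x y) = (\<Sum>x\<in>R. \<Sum>y\<in>R. f x y)"
      for f :: "'a \<Rightarrow> 'a \<Rightarrow> real"
    proof -
      have RV: "V \<inter> R = R" using \<open>R \<subset> V\<close> by auto
      have "(\<Sum>x\<in>V. \<Sum>y\<in>V. \<rho> v x * \<rho> v y * f x y) =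
          (\<Sum>x\<in>V. if x \<in> R then (\<Sum>y\<in>V. if y \<in> R then f x y else 0) else 0)"
        by (intro sum.cong refl) (auto simp: \<rho> intro!: sum.cong sum.neutral)
      also have "\<dots> = (\<Sum>x\<in>R. \<Sum>y\<in>R. f x y)"
        using psubset.hyps by (simp add: sum.If_cases RV)
      finally show ?thesis .
    qed
    define C where "C = (\<lambda>s. \<Sum>x\<in>V. \<Sum>y\<in>V. g x y * (1 + s x * s y) / 2 + h x y)"
    \<comment> \<open>\<open>\<sigma>\<close> is the flip of the cut of \<open>R\<close>: adding the
      costs for both signs cancels the terms linear in \<open>\<sigma>\<close>, so pairs with one
      end in \<open>R\<close> count as half cut.\<close>
    define s' where "s' = (\<lambda>\<sigma> x. t v x + \<sigma> * \<rho> v x * s x)"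
    have s': "s' \<sigma> x \<in> {1, -1}" if "\<sigma> \<in> {1, -1}" for \<sigma> x
      using that s[of x] vals[of v x] by (auto simp: s'_def t_def \<rho>_def)
    have t\<rho>: "t v x * \<rho> v x = 0" for x
      using vals[of v x] by (auto simp: t_def \<rho>_def)
    have "C (s' 1) + C (s' (- 1)) = (\<Sum>x\<in>V. \<Sum>y\<in>V. 1 - K v x y - \<rho> v x * \<rho> v y
        + 2 * (\<rho> v x * \<rho> v y * (g x y * (1 + s x * s y) / 2 + h x y)))"
      unfolding C_def sum.distrib[symmetric]
    proof (intro sum.cong refl)
      fix x y
      \<comment> \<open>\<open>t v\<close> and \<open>\<rho> v\<close> have disjoint supports, so
        their mixed products vanish.\<close>
      have "K v x y = 1 - g x y * (1 + t v x * t v y) - 2 * h x y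
          - \<rho> v x * \<rho> v y * (1 - g x y - 2 * h x y)"
        using t\<rho>[of x] by (auto simp: K_def algebra_simps)
      then show "g x y * (1 + s' 1 x * s' 1 y) / 2 + h x y
          + (g x y * (1 + s' (- 1) x * s' (- 1) y) / 2 + h x y)
        = 1 - K v x y - \<rho> v x * \<rho> v y
          + 2 * (\<rho> v x * \<rho> v y * (g x y * (1 + s x * s y) / 2 + h x y))"
        unfolding s'_def by (simp add: field_simps)
    qed
    also have "\<dots> = (real (card V))\<^sup>2 - (\<Sum>x\<in>V. \<Sum>y\<in>V. K v x y) - (real (card R))\<^sup>2
        + 2 * (\<Sum>x\<in>R. \<Sum>y\<in>R. g x y * (1 + s x * s y) / 2 + h x y)"
    proof -
      have "(\<Sum>x\<in>V. \<Sum>y\<in>V. 1 - K v x y - \<rho> v x * \<rho> v y + 2 * f x y) =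
          (real (card V))\<^sup>2 - (\<Sum>x\<in>V. \<Sum>y\<in>V. K v x y)
          - (\<Sum>x\<in>V. \<Sum>y\<in>V. \<rho> v x * \<rho> v y) + 2 * (\<Sum>x\<in>V. \<Sum>y\<in>V. f x y)" for f
        by (simp add: sum.distrib sum_subtractf sum_distrib_left power2_eq_square)
      moreover have "(\<Sum>x\<in>V. \<Sum>y\<in>V. \<rho> v x * \<rho> v y) = (real (card R))\<^sup>2"
        using on_R[of "\<lambda>_ _. 1"] by (simp add: power2_eq_square)
      ultimately show ?thesis
        by (simp only: on_R)
    qed
    also have "\<dots> \<le> (real (card V))\<^sup>2"
      using K cut by linarith
    finally have "C (s' 1) \<le> (real (card V))\<^sup>2 / 2 \<or> C (s' (- 1)) \<le> (real (card V))\<^sup>2 / 2"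
      by linarith
    then show ?thesis
      using s'[of 1] s'[of "-1"] unfolding C_def by blast
  qed
qed

section \<open>From 0/1-valued functions back to edge sets\<close>

lemma finite_edges:
  assumes "finite_simple_graph V E"
  shows "finite E"
  using assms finite_subset[of E "Pow V"] by (auto simp: finite_simple_graph_def)

text \<open>An edge \<open>{a, b}\<close> arises from exactly \<open>(a, b)\<close> and
  \<open>(b, a)\<close>; diagonal pairs give singletons, never edges.\<close>

lemma sum_ordered_pairs_eq_double_card:
  assumes "finite_simple_graph V D"
  shows "(\<Sum>x\<in>V. \<Sum>y\<in>V. of_bool ({x, y} \<in> D)) = 2 * real (card D)"
proof -
  have fin: "finite V" and sub: "\<And>e. e \<in> D \<Longrightarrow> e \<subseteq> V \<and> card e = 2"
    using assms by (auto simp: finite_simple_graph_def)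
  have "finite D" using assms by (rule finite_edges)
  have "(\<Sum>x\<in>V. \<Sum>y\<in>V. of_bool ({x, y} \<in> D)) =
      (\<Sum>x\<in>V. \<Sum>y\<in>V. \<Sum>e\<in>D. of_bool (e = {x, y}) :: real)"
    using \<open>finite D\<close> by (intro sum.cong refl) (auto simp: of_bool_def)
  also have "\<dots> = (\<Sum>x\<in>V. \<Sum>e\<in>D. \<Sum>y\<in>V. of_bool (e = {x, y}))"
    by (intro sum.cong refl sum.swap)
  also have "\<dots> = (\<Sum>e\<in>D. \<Sum>x\<in>V. \<Sum>y\<in>V. of_bool (e = {x, y}))"
    by (rule sum.swap)
  also have "\<dots> = (\<Sum>e\<in>D. 2)"
  proof (intro sum.cong refl)
    fix e assume "e \<in> D"
    then obtain a b where ab: "e = {a, b}" "a \<noteq> b" "a \<in> V" "b \<in> V"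
      using sub by (metis card_2_iff insert_subset)
    have "(\<Sum>x\<in>V. \<Sum>y\<in>V. of_bool (e = {x, y}) :: real) =
        (\<Sum>p\<in>V \<times> V. of_bool (p \<in> {(a, b), (b, a)}))"
      unfolding sum.cartesian_product
      by (intro sum.cong refl) (auto simp: ab(1) doubleton_eq_iff of_bool_def split: if_splits)
    also have "\<dots> = real (card {(a, b), (b, a)})"
    proof -
      have "(V \<times> V) \<inter> {(a, b), (b, a)} = {(a, b), (b, a)}" using ab by auto
      then show ?thesis
        using fin sum.inter_restrict[of "V \<times> V" "\<lambda>_. 1::real" "{(a, b), (b, a)}"]
        by (simp add: of_bool_def)
    qed
    finally show "(\<Sum>x\<in>V. \<Sum>y\<in>V. of_bool (e = {x, y}) :: real) = 2"
      using ab by simp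
  qed
  finally show ?thesis by simp
qed

text \<open>Supplies the condition \<open>indep\<close> of \<open>exists_good_cut\<close>.\<close>

lemma triangle_independent_no_two_edges:
  assumes "finite_simple_graph V E" "triangle_independent E F"
    and "{x, y} \<in> F" "{x, z} \<in> F"
  shows "{y, z} \<notin> E"
proof
  assume yz: "{y, z} \<in> E"
  have FE: "F \<subseteq> E" using assms(2) by (simp add: triangle_independent_def)
  have ne: "u \<noteq> w" if "{u, w} \<in> E" for u w
    using assms(1) that by (force simp: finite_simple_graph_def)
  have dist: "x \<noteq> y" "y \<noteq> z" "x \<noteq> z"
    using ne yz assms(3,4) FE by blast+
  let ?T = "{{x, y}, {y, z}, {x, z}}"
  have "?T \<in> triangles E"
    unfolding triangles_def using dist yz assms(3,4) FE by blast
  then have "card (F \<inter> ?T) \<le> 1"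
    using assms(2) by (simp add: triangle_independent_def)
  moreover have "card {{x, y}, {x, z}} \<le> card (F \<inter> ?T)"
    using assms(3,4) by (intro card_mono) auto
  ultimately show False
    using dist by (auto simp: doubleton_eq_iff)
qed

lemma triangle_independent_plus_tau_B_le:
  assumes graph: "finite_simple_graph V E" and F: "triangle_independent E F"
  shows "real (card F) + real (tau_B V E) \<le> (real (card V))\<^sup>2 / 4"
proof -
  have fin: "finite V" and sub: "\<And>e. e \<in> E \<Longrightarrow> e \<subseteq> V \<and> card e = 2"
    using graph by (auto simp: finite_simple_graph_def)
  have finE: "finite E" using graph by (rule finite_edges)
  have FE: "F \<subseteq> E" using F by (simp add: triangle_independent_def)
  define g h :: "'a \<Rightarrow> 'a \<Rightarrow> real"
    where "g = (\<lambda>x y. of_bool ({x, y} \<in> E))" and "h = (\<lambda>x y. of_bool ({x, y} \<in> F))"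
  have "\<exists>s. (\<forall>x. s x \<in> {1, -1}) \<and>
    (\<Sum>x\<in>V. \<Sum>y\<in>V. g x y * (1 + s x * s y) / 2 + h x y) \<le> (real (card V))\<^sup>2 / 2"
  proof (rule exists_good_cut[OF fin])
    show "(g x y, h x y) \<in> {(0, 0), (1, 0), (1, 1)}" for x y
      using FE by (auto simp: g_def h_def)
    show "g x x = 0" for x
      using sub by (force simp: g_def)
    show "g x y = g y x" "h x y = h y x" for x y
      by (simp_all add: g_def h_def insert_commute)
    show "h x y * h x z * g y z = 0" for x y z
      using triangle_independent_no_two_edges[OF graph F, of x y z] by (auto simp: g_def h_def)
  qed
  then obtain s where s: "\<And>x. s x \<in> {1, -1}"
    and cut: "(\<Sum>x\<in>V. \<Sum>y\<in>V. g x y * (1 + s x * s y) / 2 + h x y) \<le> (real (card V))\<^sup>2 / 2"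
    by blast
  \<comment> \<open>The uncut edges: deleting them leaves the two sign classes of \<open>s\<close>
    as a bipartition, so \<open>card D\<close> bounds \<open>tau_B V E\<close>.\<close>
  define D where "D = {e \<in> E. \<forall>x\<in>e. \<forall>y\<in>e. s x = s y}"
  have DE: "D \<subseteq> E" by (auto simp: D_def)
  have "g x y * (1 + s x * s y) / 2 = of_bool ({x, y} \<in> D)" for x y
  proof -
    have "{x, y} \<in> D \<longleftrightarrow> {x, y} \<in> E \<and> s x = s y" unfolding D_def by auto
    moreover have "(1 + s x * s y) / 2 = of_bool (s x = s y)"
      using s[of x] s[of y] by (elim insertE emptyE) simp_all
    ultimately show ?thesis
      by (simp only: g_def of_bool_conj times_divide_eq_right[symmetric])
  qed
  moreover have "finite_simple_graph V D" "finite_simple_graph V F"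
    using graph DE FE by (auto simp: finite_simple_graph_def)
  ultimately have "(\<Sum>x\<in>V. \<Sum>y\<in>V. g x y * (1 + s x * s y) / 2 + h x y) =
      2 * real (card D) + 2 * real (card F)"
    by (simp only: sum.distrib h_def sum_ordered_pairs_eq_double_card)
  with cut have DF: "real (card D) + real (card F) \<le> (real (card V))\<^sup>2 / 4"
    by simp
  have "bipartite V (E - D)"
    unfolding bipartite_def
  proof (intro exI conjI ballI)
    let ?A = "{x \<in> V. s x = 1}" and ?B = "{x \<in> V. s x = -1}"
    show "?A \<union> ?B = V" using s by auto
    show "?A \<inter> ?B = {}" by auto
    fix e assume e: "e \<in> E - D"
    then obtain x y where xy: "x \<in> e" "y \<in> e" "s x \<noteq> s y"
      by (auto simp: D_def)
    moreover have "e \<subseteq> V" "card e = 2" using e sub by auto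
    ultimately have "e = {x, y}" by (auto simp: card_2_iff)
    then show "\<exists>a\<in>?A. \<exists>b\<in>?B. e = {a, b}"
      using xy s[of x] s[of y] \<open>e \<subseteq> V\<close> by (auto simp: insert_commute)
  qed
  then have "tau_B V E \<le> card D"
    unfolding tau_B_def using DE finE by (intro Min_le) auto
  then show ?thesis using DF by linarith
qed

theorem theorem5p3:
  fixes V :: "'a set" and E :: "'a set set" and n :: nat
  assumes "finite_simple_graph V E"
    and "card V = n"
  shows "real (alpha1 E) + real (tau_B V E) \<le> 4403 * (real n)\<^sup>2 / 15000"
proof -
  have "finite E" using assms(1) by (rule finite_edges)
  then have "finite {card F | F. triangle_independent E F}"
    by (auto simp: triangle_independent_def intro: finite_subset[of _ "card ` Pow E"])
  moreover have "triangle_independent E {}"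
    by (simp add: triangle_independent_def)
  ultimately have "alpha1 E \<in> {card F | F. triangle_independent E F}"
    unfolding alpha1_def by (intro Max_in) auto
  then obtain F where "triangle_independent E F" "alpha1 E = card F"
    by auto
  with triangle_independent_plus_tau_B_le[OF assms(1)] assms(2)
  have "real (alpha1 E) + real (tau_B V E) \<le> (real n)\<^sup>2 / 4"
    by metis
  \<comment> \<open>Here 1/4 = 3750/15000.\<close>
  also have "\<dots> \<le> 4403 * (real n)\<^sup>2 / 15000"
    by simp
  finally show ?thesis .
qed

end
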